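(* The following typing rules for the language $\mathcal L^\omega$ over a $\mathcal{{}^KOCA}$ are adequate: (ax): from no premises, $\Gamma\vdash x_i:A_i^o$, where $x_i:A_i^o$ appears in $\Gamma$; ($\to_i$): from $\Gamma,x:A^o\vdash p:B^o$ infer $\Gamma\vdash \mathrm e(\lambda^*x\,p):(A^o\Rightarrow B^o)^o$; ($\to_e$): from $\Gamma\vdash p:(A^o\Rightarrow B^o)^o$ and $\Gamma\vdash q:A^o$ infer $\Gamma\vdash pq:B^o$; ($\forall_i$): from $\Gamma\vdash p:A^o$ infer $\Gamma\vdash p:(\forall x^\sigma A^o)^o$, where $x^\sigma$ does not appear free in $\Gamma$; ($\forall_e$): from $\Gamma\vdash p:(\forall x^\sigma A^o)^o$ infer $\Gamma\vdash p:A^o\{x^\sigma:=M^\sigma\}$, for any expression $M^\sigma$ of kind $\sigma$. Here a rule with premises $S_1,\dots,S_h$ and conclusion $S_{h+1}$ is adequate if for every $\mathcal{{}^KOCA}$ $\mathcal A$: if $\mathcal A\models S_1,\dots,\mathcal A\models S_h$ then $\mathcal A\models S_{h+1}$.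
   Context: An ordered combinatory algebra (OCA) is $(A,\circ,\le,\mathrm k,\mathrm s)$ with $A$ a set, $\circ:A\times A\to A$ a binary operation (application, $a\circ b=ab$, associating to the left), $\le$ a partial order on $A$, and $\mathrm k,\mathrm s\in A$, such that application is monotone in both arguments and $\mathrm kab\le a$, $\mathrm sabc\le ac(bc)$ for all $a,b,c\in A$. An implication is a map $\to:A\times A\to A$, monotone in the second variable and antimonotone in the first, such that $a\le(b\to c)$ implies $ab\le c$. An adjunctor is an element $\mathrm e\in A$ such that $ab\le c$ implies $\mathrm ea\le(b\to c)$. The OCA is classic if there is $\mathrm c\in A$ with $\mathrm c\le(((a\to b)\to a)\to a)$ for all $a,b$. A filter is a subset $\Phi\subseteq A$ closed under application, containing $\mathrm k$ and $\mathrm s$, containing $\mathrm e$, and containing $\mathrm c$ if $A$ is classic. A $\mathcal{{}^KOCA}$ $\mathcal A$ is an OCA (with underlying set $A$) equipped with an implication $\to$, an adjunctor $\mathrm e$ and a filter $\Phi$, in which every subset $X\subseteq A$ has an infimum $\inf(X)$. Polynomials (terms) over $A$: formal expressions built from elements of $A$ and variables $x_1,x_2,\dots$ by application; $A[x_1,\dots,x_k]$ denotes those with variables among $x_1,\dots,x_k$. Closed terms are evaluated in $A$. For a variable $y$, $\lambda^*y$ is defined recursively: $\lambda^*y(t)=\mathrm kt$ if $y$ does not occur in $t$; $\lambda^*y(y)=\mathrm{skk}$; otherwise $\lambda^*y(tu)=\mathrm s(\lambda^*y(t))(\lambda^*y(u))$. Language. Kinds are generated from a set of constants of kinds, one of which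 is denoted $o$, by $\sigma,\tau::=c\mid\sigma\to\tau$. For each kind $\tau$ there are infinitely many variables $x^\tau$; there are also constants $a^\tau$ labelled by kinds. Expressions of $\mathcal L^\omega$, labelled by kinds, are: variables $x^\sigma$; constants $a^\sigma$; $(\lambda x^\sigma.M^\tau)^{\sigma\to\tau}$; $(N^{\sigma\to\tau}M^\sigma)^\tau$; $(A^o\Rightarrow B^o)^o$; $(\forall x^\tau.A^o)^o$. Expressions of kind $o$ are called formulae. Substitution $\{x^\sigma:=M^\sigma\}$ is capture-avoiding. Sequents. A context $\Gamma$ is a finite sequence of declarations $x_1:A_1^o,\dots,x_k:A_k^o$, with $x_1,\dots,x_k$ distinct variables of polynomials and $A_i^o$ formulae. A sequent is $x_1:A_1^o,\dots,x_k:A_k^o\vdash p:B^o$ with $p\in A[x_1,\dots,x_k]$ and $B^o$ a formula. Semantics in $\mathcal A$. Each constant of kind $c$ is interpreted by a set $[\![c]\!]$, with $[\![o]\!]=A$, and $[\![\sigma\to\tau]\!]=[\![\tau]\!]^{[\![\sigma]\!]}$ (all functions). Each constant $a^\sigma$ is interpreted by an element $[\![a^\sigma]\!]\in[\![\sigma]\!]$. Given an assignment $\mathfrak a$ with $\mathfrak a(x^\sigma)\in[\![\sigma]\!]$ for every variable $x^\sigma$ (where $\{x^\sigma:=s\}$ applied to an assignment or interpretation redefines the value at $x^\sigma$ to be $s$): $[\![x^\sigma]\!]=\mathfrak a(x^\sigma)$; $[\![\lambda x^\sigma M^\tau]\!](s)=[\![M^\tau]\!]\{x^\sigma:=s\}$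 for $s\in[\![\sigma]\!]$; $[\![N^{\sigma\to\tau}M^\sigma]\!]=[\![N^{\sigma\to\tau}]\!]([\![M^\sigma]\!])$; $[\![A^o\Rightarrow B^o]\!]=[\![A^o]\!]\to[\![B^o]\!]$; $[\![\forall x^\sigma A^o]\!]=\inf\{[\![A^o]\!]\{x^\sigma:=s\}: s\in[\![\sigma]\!]\}$. $\mathcal A\models x_1:A_1^o,\dots,x_k:A_k^o\vdash p:B^o$ means: for every assignment $\mathfrak a$ and all $b_1,\dots,b_k\in A$, if $b_1\le[\![A_1^o]\!],\dots,b_k\le[\![A_k^o]\!]$ then $p\{x_1:=b_1,\dots,x_k:=b_k\}\le[\![B^o]\!]$. *)

theory Defs
  imports "HOL-Algebra.Lattice" "HOL-Library.FuncSet"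
begin

section \<open>Ordered combinatory algebras\<close>

record 'v oca = "'v gorder" +
  appl :: "'v \<Rightarrow> 'v \<Rightarrow> 'v"  (infixl \<open>\<cdot>\<index>\<close> 70)
  kcomb :: 'v
  scomb :: 'v

locale OCA = partial_order A for A :: "('v, 'm) oca_scheme" (structure) +
  assumes appl_closed: "\<lbrakk>a \<in> carrier A; b \<in> carrier A\<rbrakk> \<Longrightarrow> a \<cdot> b \<in> carrier A"
    and kcomb_closed: "kcomb A \<in> carrier A"
    and scomb_closed: "scomb A \<in> carrier A"
    and appl_mono:
      "\<lbrakk>a \<in> carrier A; a' \<in> carrier A; b \<in> carrier A; b' \<in> carrier A; a \<sqsubseteq> a'; b \<sqsubseteq> b'\<rbrakk>
        \<Longrightarrow> a \<cdot> b \<sqsubseteq> a' \<cdot> b'"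
    and kcomb_le: "\<lbrakk>a \<in> carrier A; b \<in> carrier A\<rbrakk> \<Longrightarrow> kcomb A \<cdot> a \<cdot> b \<sqsubseteq> a"
    and scomb_le:
      "\<lbrakk>a \<in> carrier A; b \<in> carrier A; c \<in> carrier A\<rbrakk>
        \<Longrightarrow> scomb A \<cdot> a \<cdot> b \<cdot> c \<sqsubseteq> a \<cdot> c \<cdot> (b \<cdot> c)"

definition implication :: "('v, 'm) oca_scheme \<Rightarrow> ('v \<Rightarrow> 'v \<Rightarrow> 'v) \<Rightarrow> bool" where
  "implication A impl \<longleftrightarrow>
    (\<forall>a\<in>carrier A. \<forall>b\<in>carrier A. impl a b \<in> carrier A) \<and>
    (\<forall>a\<in>carrier A. \<forall>b\<in>carrier A. \<forall>b'\<in>carrier A.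
       b \<sqsubseteq>\<^bsub>A\<^esub> b' \<longrightarrow> impl a b \<sqsubseteq>\<^bsub>A\<^esub> impl a b') \<and>
    (\<forall>a\<in>carrier A. \<forall>a'\<in>carrier A. \<forall>b\<in>carrier A.
       a \<sqsubseteq>\<^bsub>A\<^esub> a' \<longrightarrow> impl a' b \<sqsubseteq>\<^bsub>A\<^esub> impl a b) \<and>
    (\<forall>a\<in>carrier A. \<forall>b\<in>carrier A. \<forall>c\<in>carrier A.
       a \<sqsubseteq>\<^bsub>A\<^esub> impl b c \<longrightarrow> a \<cdot>\<^bsub>A\<^esub> b \<sqsubseteq>\<^bsub>A\<^esub> c)"

definition adjunctor :: "('v, 'm) oca_scheme \<Rightarrow> ('v \<Rightarrow> 'v \<Rightarrow> 'v) \<Rightarrow> 'v \<Rightarrow> bool" where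
  "adjunctor A impl e \<longleftrightarrow> e \<in> carrier A \<and>
    (\<forall>a\<in>carrier A. \<forall>b\<in>carrier A. \<forall>c\<in>carrier A.
       a \<cdot>\<^bsub>A\<^esub> b \<sqsubseteq>\<^bsub>A\<^esub> c \<longrightarrow> e \<cdot>\<^bsub>A\<^esub> a \<sqsubseteq>\<^bsub>A\<^esub> impl b c)"

definition classic_elt :: "('v, 'm) oca_scheme \<Rightarrow> ('v \<Rightarrow> 'v \<Rightarrow> 'v) \<Rightarrow> 'v \<Rightarrow> bool" where
  "classic_elt A impl c \<longleftrightarrow> c \<in> carrier A \<and>
    (\<forall>a\<in>carrier A. \<forall>b\<in>carrier A. c \<sqsubseteq>\<^bsub>A\<^esub> impl (impl (impl a b) a) a)"

definition classic :: "('v, 'm) oca_scheme \<Rightarrow> ('v \<Rightarrow> 'v \<Rightarrow> 'v) \<Rightarrow> bool" where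
  "classic A impl \<longleftrightarrow> (\<exists>c. classic_elt A impl c)"

definition oca_filter ::
    "('v, 'm) oca_scheme \<Rightarrow> ('v \<Rightarrow> 'v \<Rightarrow> 'v) \<Rightarrow> 'v \<Rightarrow> 'v set \<Rightarrow> bool" where
  "oca_filter A impl e F \<longleftrightarrow> F \<subseteq> carrier A \<and>
    (\<forall>a\<in>F. \<forall>b\<in>F. a \<cdot>\<^bsub>A\<^esub> b \<in> F) \<and> kcomb A \<in> F \<and> scomb A \<in> F \<and> e \<in> F \<and>
    (classic A impl \<longrightarrow> (\<exists>c\<in>F. classic_elt A impl c))"

record 'v koca = "'v oca" +
  impl :: "'v \<Rightarrow> 'v \<Rightarrow> 'v"
  adj :: 'v
  filt :: "'v set"

locale KOCA = OCA A for A :: "'v koca" (structure) +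
  assumes implication: "implication A (impl A)"
    and adjunctor: "adjunctor A (impl A) (adj A)"
    and filter: "oca_filter A (impl A) (adj A) (filt A)"
    and inf_exists: "X \<subseteq> carrier A \<Longrightarrow> \<exists>i. greatest A i (Lower A X)"


section \<open>Polynomials\<close>

datatype 'v poly_term = PVar nat | PElt 'v | PApp "'v poly_term" "'v poly_term"

primrec pvars :: "'v poly_term \<Rightarrow> nat set" where
  "pvars (PVar x) = {x}"
| "pvars (PElt a) = {}"
| "pvars (PApp t u) = pvars t \<union> pvars u"

primrec pelts :: "'v poly_term \<Rightarrow> 'v set" where
  "pelts (PVar x) = {}"
| "pelts (PElt a) = {a}"
| "pelts (PApp t u) = pelts t \<union> pelts u"

definition polynomials :: "('v, 'm) oca_scheme \<Rightarrow> nat set \<Rightarrow> 'v poly_term set" where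
  "polynomials A X = {p. pvars p \<subseteq> X \<and> pelts p \<subseteq> carrier A}"

text \<open>The value in \<open>A\<close> of the closed term obtained from \<open>p\<close> by substituting \<open>b x\<close> for every
  variable \<open>x\<close>.\<close>

primrec pvalue :: "('v, 'm) oca_scheme \<Rightarrow> (nat \<Rightarrow> 'v) \<Rightarrow> 'v poly_term \<Rightarrow> 'v" where
  "pvalue A b (PVar x) = b x"
| "pvalue A b (PElt a) = a"
| "pvalue A b (PApp t u) = pvalue A b t \<cdot>\<^bsub>A\<^esub> pvalue A b u"

primrec lamstar :: "('v, 'm) oca_scheme \<Rightarrow> nat \<Rightarrow> 'v poly_term \<Rightarrow> 'v poly_term" where
  "lamstar A y (PVar x) =
    (if x = y then PApp (PApp (PElt (scomb A)) (PElt (kcomb A))) (PElt (kcomb A))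
     else PApp (PElt (kcomb A)) (PVar x))"
| "lamstar A y (PElt a) = PApp (PElt (kcomb A)) (PElt a)"
| "lamstar A y (PApp t u) =
    (if y \<notin> pvars (PApp t u) then PApp (PElt (kcomb A)) (PApp t u)
     else PApp (PApp (PElt (scomb A)) (lamstar A y t)) (lamstar A y u))"


section \<open>The language\<close>

text \<open>\<open>Omicron\<close> is the distinguished constant of kinds \<open>o\<close>.\<close>

datatype 'c kind = Omicron | KConst 'c | Arr "'c kind" "'c kind"

text \<open>A variable is a pair of a name and a kind, so each kind has infinitely many variables.\<close>

type_synonym 'c var = "nat \<times> 'c kind"

datatype ('c, 'k) expr =
    Var "'c var"
  | Cst 'k "'c kind"
  | Lam "'c var" "('c, 'k) expr"
  | App "('c, 'k) expr" "('c, 'k) expr"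
  | Imp "('c, 'k) expr" "('c, 'k) expr"
  | All "'c var" "('c, 'k) expr"

text \<open>The kind label; it is meaningful for the expressions satisfying \<open>wf_expr\<close> below.\<close>

primrec kind_of :: "('c, 'k) expr \<Rightarrow> 'c kind" where
  "kind_of (Var v) = snd v"
| "kind_of (Cst a \<sigma>) = \<sigma>"
| "kind_of (Lam v M) = Arr (snd v) (kind_of M)"
| "kind_of (App N M) = (case kind_of N of Arr \<sigma> \<tau> \<Rightarrow> \<tau> | _ \<Rightarrow> Omicron)"
| "kind_of (Imp A B) = Omicron"
| "kind_of (All v A) = Omicron"

text \<open>
  A language is given by its constants together with its kinds. The full language over a set
  \<open>C\<close> of constants of kinds other than \<open>o\<close> is the case where \<open>kinds L\<close> consists of all kinds
  generated from \<open>o\<close> and \<open>C\<close> (so \<open>kinds L = UNIV\<close> if \<open>C\<close> is the whole type). Fragments that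
  are only closed under taking the components of an arrow are admitted as well: over an
  infinite algebra, the full function spaces for infinitely many nested kinds cannot be shown
  to fit into a single HOL type, whereas those for any finite set of kinds always can.
\<close>

record ('c, 'k) language =
  kinds :: "'c kind set"
  csts :: "('k \<times> 'c kind) set"

definition is_language :: "('c, 'k) language \<Rightarrow> bool" where
  "is_language L \<longleftrightarrow> Omicron \<in> kinds L \<and>
    (\<forall>\<sigma> \<tau>. Arr \<sigma> \<tau> \<in> kinds L \<longrightarrow> \<sigma> \<in> kinds L \<and> \<tau> \<in> kinds L) \<and>
    csts L \<subseteq> UNIV \<times> kinds L"

primrec wf_expr :: "('c, 'k) language \<Rightarrow> ('c, 'k) expr \<Rightarrow> bool" where
  "wf_expr L (Var v) \<longleftrightarrow> snd v \<in> kinds L"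
| "wf_expr L (Cst a \<sigma>) \<longleftrightarrow> (a, \<sigma>) \<in> csts L"
| "wf_expr L (Lam v M) \<longleftrightarrow> wf_expr L M \<and> Arr (snd v) (kind_of M) \<in> kinds L"
| "wf_expr L (App N M) \<longleftrightarrow> wf_expr L N \<and> wf_expr L M \<and> (\<exists>\<tau>. kind_of N = Arr (kind_of M) \<tau>)"
| "wf_expr L (Imp A B) \<longleftrightarrow>
    wf_expr L A \<and> kind_of A = Omicron \<and> wf_expr L B \<and> kind_of B = Omicron"
| "wf_expr L (All v A) \<longleftrightarrow> snd v \<in> kinds L \<and> wf_expr L A \<and> kind_of A = Omicron"

definition expressions :: "('c, 'k) language \<Rightarrow> 'c kind \<Rightarrow> ('c, 'k) expr set" where
  "expressions L \<sigma> = {M. wf_expr L M \<and> kind_of M = \<sigma>}"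

abbreviation formulae :: "('c, 'k) language \<Rightarrow> ('c, 'k) expr set" where
  "formulae L \<equiv> expressions L Omicron"

primrec FV :: "('c, 'k) expr \<Rightarrow> 'c var set" where
  "FV (Var v) = {v}"
| "FV (Cst a \<sigma>) = {}"
| "FV (Lam v M) = FV M - {v}"
| "FV (App N M) = FV N \<union> FV M"
| "FV (Imp A B) = FV A \<union> FV B"
| "FV (All v A) = FV A - {v}"

text \<open>
  Capture-avoiding substitution, defined simultaneously for all variables so that it is
  structurally recursive: a bound variable is renamed, keeping its kind, exactly when it would
  capture a variable of an expression substituted into the scope of the binder.
\<close>

definition fresh_binder ::
    "('c var \<Rightarrow> ('c, 'k) expr) \<Rightarrow> 'c var \<Rightarrow> ('c, 'k) expr \<Rightarrow> 'c var" where
  "fresh_binder \<theta> v M =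
    (let avoid = (\<Union>w\<in>FV M - {v}. FV (\<theta> w))
     in if v \<in> avoid then (LEAST n. (n, snd v) \<notin> avoid, snd v) else v)"

primrec subst :: "('c, 'k) expr \<Rightarrow> ('c var \<Rightarrow> ('c, 'k) expr) \<Rightarrow> ('c, 'k) expr" where
  "subst (Var v) \<theta> = \<theta> v"
| "subst (Cst a \<sigma>) \<theta> = Cst a \<sigma>"
| "subst (Lam v M) \<theta> = (let z = fresh_binder \<theta> v M in Lam z (subst M (\<theta>(v := Var z))))"
| "subst (App N M) \<theta> = App (subst N \<theta>) (subst M \<theta>)"
| "subst (Imp A B) \<theta> = Imp (subst A \<theta>) (subst B \<theta>)"
| "subst (All v A) \<theta> = (let z = fresh_binder \<theta> v A in All z (subst A (\<theta>(v := Var z))))"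

definition subst1 :: "('c, 'k) expr \<Rightarrow> 'c var \<Rightarrow> ('c, 'k) expr \<Rightarrow> ('c, 'k) expr" where
  "subst1 A v M = subst A (Var(v := M))"


section \<open>Sequents\<close>

type_synonym ('c, 'k) ctxt = "(nat \<times> ('c, 'k) expr) list"
type_synonym ('c, 'k, 'v) sequent = "('c, 'k) ctxt \<times> 'v poly_term \<times> ('c, 'k) expr"

definition contexts :: "('c, 'k) language \<Rightarrow> ('c, 'k) ctxt set" where
  "contexts L = {\<Gamma>. distinct (map fst \<Gamma>) \<and> snd ` set \<Gamma> \<subseteq> formulae L}"

definition sequents :: "('c, 'k) language \<Rightarrow> 'v koca \<Rightarrow> ('c, 'k, 'v) sequent set" where
  "sequents L A =
    {(\<Gamma>, p, B). \<Gamma> \<in> contexts L \<and> p \<in> polynomials A (fst ` set \<Gamma>) \<and> B \<in> formulae L}"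


section \<open>Semantics\<close>

text \<open>
  \<open>Dom \<sigma>\<close> is the set interpreting \<open>\<sigma>\<close>. An element of \<open>Dom (Arr \<sigma> \<tau>)\<close> stands for the function
  \<open>Ap \<sigma> \<tau> f\<close> on \<open>Dom \<sigma>\<close>; \<open>is_interp\<close> requires that every function from \<open>Dom \<sigma>\<close> to \<open>Dom \<tau>\<close> is
  represented exactly once.
\<close>

record ('c, 'k, 'v) interp =
  Dom :: "'c kind \<Rightarrow> 'v set"
  Ap :: "'c kind \<Rightarrow> 'c kind \<Rightarrow> 'v \<Rightarrow> 'v \<Rightarrow> 'v"
  Val :: "'k \<Rightarrow> 'c kind \<Rightarrow> 'v"

definition is_interp ::
    "('c, 'k) language \<Rightarrow> 'v koca \<Rightarrow> ('c, 'k, 'v) interp \<Rightarrow> bool" where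
  "is_interp L A I \<longleftrightarrow>
    Dom I Omicron = carrier A \<and>
    (\<forall>\<sigma> \<tau>. Arr \<sigma> \<tau> \<in> kinds L \<longrightarrow>
       bij_betw (\<lambda>f. restrict (Ap I \<sigma> \<tau> f) (Dom I \<sigma>)) (Dom I (Arr \<sigma> \<tau>)) (Dom I \<sigma> \<rightarrow>\<^sub>E Dom I \<tau>)) \<and>
    (\<forall>(a, \<sigma>)\<in>csts L. Val I a \<sigma> \<in> Dom I \<sigma>)"

type_synonym ('c, 'v) assignment = "'c var \<Rightarrow> 'v"

definition assignments ::
    "('c, 'k) language \<Rightarrow> ('c, 'k, 'v) interp \<Rightarrow> ('c, 'v) assignment set" where
  "assignments L I = {\<aa>. \<forall>v. snd v \<in> kinds L \<longrightarrow> \<aa> v \<in> Dom I (snd v)}"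

primrec sem ::
    "'v koca \<Rightarrow> ('c, 'k, 'v) interp \<Rightarrow> ('c, 'v) assignment \<Rightarrow> ('c, 'k) expr \<Rightarrow> 'v" where
  "sem A I \<aa> (Var v) = \<aa> v"
| "sem A I \<aa> (Cst a \<sigma>) = Val I a \<sigma>"
| "sem A I \<aa> (Lam v M) =
    (THE f. f \<in> Dom I (Arr (snd v) (kind_of M)) \<and>
       (\<forall>s\<in>Dom I (snd v). Ap I (snd v) (kind_of M) f s = sem A I (\<aa>(v := s)) M))"
| "sem A I \<aa> (App N M) =
    Ap I (kind_of M) (kind_of (App N M)) (sem A I \<aa> N) (sem A I \<aa> M)"
| "sem A I \<aa> (Imp B C) = impl A (sem A I \<aa> B) (sem A I \<aa> C)"
| "sem A I \<aa> (All v B) = \<Sqinter>\<^bsub>A\<^esub>{sem A I (\<aa>(v := s)) B | s. s \<in> Dom I (snd v)}"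

text \<open>The elements \<open>b\<^sub>1, \<dots>, b\<^sub>k\<close> are indexed by the (distinct) variables that \<open>\<Gamma>\<close> declares.\<close>

definition satisfies ::
    "('c, 'k) language \<Rightarrow> 'v koca \<Rightarrow> ('c, 'k, 'v) interp \<Rightarrow> ('c, 'k, 'v) sequent \<Rightarrow> bool" where
  "satisfies L A I = (\<lambda>(\<Gamma>, p, B).
    \<forall>\<aa>\<in>assignments L I. \<forall>b :: nat \<Rightarrow> 'v.
      (\<forall>(x, C)\<in>set \<Gamma>. b x \<in> carrier A \<and> b x \<sqsubseteq>\<^bsub>A\<^esub> sem A I \<aa> C) \<longrightarrow>
      pvalue A b p \<sqsubseteq>\<^bsub>A\<^esub> sem A I \<aa> B)"


section \<open>Typing rules and adequacy\<close>

text \<open>A rule is given, for each algebra, by its instances: pairs of premises and a conclusion.\<close>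

type_synonym ('c, 'k, 'v) rule =
  "'v koca \<Rightarrow> (('c, 'k, 'v) sequent list \<times> ('c, 'k, 'v) sequent) set"

definition adequate :: "('c, 'k) language \<Rightarrow> ('c, 'k, 'v) rule \<Rightarrow> bool" where
  "adequate L R \<longleftrightarrow>
    (\<forall>A I. KOCA A \<longrightarrow> is_interp L A I \<longrightarrow>
      (\<forall>(Ps, S)\<in>R A. (\<forall>P\<in>set Ps. satisfies L A I P) \<longrightarrow> satisfies L A I S))"

definition rule_ax :: "('c, 'k) language \<Rightarrow> ('c, 'k, 'v) rule" where
  "rule_ax L A = {([], (\<Gamma>, PVar x, B)) | \<Gamma> x B. \<Gamma> \<in> contexts L \<and> (x, B) \<in> set \<Gamma>}"

definition rule_imp_intro :: "('c, 'k) language \<Rightarrow> ('c, 'k, 'v) rule" where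
  "rule_imp_intro L A =
    {([(\<Gamma> @ [(x, C)], p, B)], (\<Gamma>, PApp (PElt (adj A)) (lamstar A x p), Imp C B)) | \<Gamma> x C p B.
      (\<Gamma> @ [(x, C)], p, B) \<in> sequents L A}"

definition rule_imp_elim :: "('c, 'k) language \<Rightarrow> ('c, 'k, 'v) rule" where
  "rule_imp_elim L A =
    {([(\<Gamma>, p, Imp C B), (\<Gamma>, q, C)], (\<Gamma>, PApp p q, B)) | \<Gamma> p q C B.
      (\<Gamma>, p, Imp C B) \<in> sequents L A \<and> (\<Gamma>, q, C) \<in> sequents L A}"

definition rule_all_intro :: "('c, 'k) language \<Rightarrow> ('c, 'k, 'v) rule" where
  "rule_all_intro L A =
    {([(\<Gamma>, p, B)], (\<Gamma>, p, All (x, \<sigma>) B)) | \<Gamma> p B x \<sigma>.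
      (\<Gamma>, p, B) \<in> sequents L A \<and> \<sigma> \<in> kinds L \<and> (\<forall>(y, C)\<in>set \<Gamma>. (x, \<sigma>) \<notin> FV C)}"

definition rule_all_elim :: "('c, 'k) language \<Rightarrow> ('c, 'k, 'v) rule" where
  "rule_all_elim L A =
    {([(\<Gamma>, p, All (x, \<sigma>) B)], (\<Gamma>, p, subst1 B (x, \<sigma>) M)) | \<Gamma> p B x \<sigma> M.
      (\<Gamma>, p, All (x, \<sigma>) B) \<in> sequents L A \<and> M \<in> expressions L \<sigma>}"

end

theory Submission
  imports Defs
begin

text \<open>
  A rule that introduces or eliminates a connective is adequate because the semantic operation
  behind the connective has the matching order-theoretic property; the rest is bookkeeping with
  assignments.

  Implication is almost right adjoint to application. For \<open>\<Rightarrow>\<close>, elimination is one half of this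
  adjunction, that \<open>a \<le> (b \<rightarrow> c)\<close> implies \<open>a b \<le> c\<close>. Introduction uses the other half, which
  holds up to the adjunctor: it turns an inequality \<open>(\<lambda>\<^sup>*x p) c \<le> b\<close> into
  \<open>e (\<lambda>\<^sup>*x p) \<le> (c \<rightarrow> b)\<close>, and the former holds because
  \<open>\<lambda>\<^sup>*\<close> satisfies beta reduction as an inequality (\<open>lamstar_beta\<close>). It is enough to take for
  \<open>c\<close> the interpretation of the hypothesis itself, the largest realizer that the premise admits.

  For \<open>\<forall>\<close>, introduction says that a lower bound of a family is below its infimum. The bound has
  to hold at every value of the quantified variable, whence the condition that this variable is
  not free in the context: changing its value changes no hypothesis (\<open>sem_cong\<close>). Elimination
  says that the infimum is below the member of the family at the value of \<open>M\<close>; that value lies in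
  the range of the quantifier (\<open>sem_in_Dom\<close>), and the member at it is the meaning of the
  substituted formula (\<open>sem_subst\<close>). The substitution lemma is proved for simultaneous
  substitutions, since passing under a binder already turns a single substitution into a
  simultaneous one.
\<close>

section \<open>Combinatory abstraction\<close>

context OCA
begin

lemma pvalue_closed:
  assumes "p \<in> polynomials A X" "\<And>x. x \<in> X \<Longrightarrow> b x \<in> carrier A"
  shows "pvalue A b p \<in> carrier A"
  using assms by (induction p) (auto simp: polynomials_def intro!: appl_closed)

lemma lamstar_polynomial:
  assumes "p \<in> polynomials A X"
  shows "lamstar A y p \<in> polynomials A (X - {y})"
  using assms kcomb_closed scomb_closed
  by (induction p) (auto simp: polynomials_def)

lemma pvalue_cong:
  "(\<And>x. x \<in> pvars p \<Longrightarrow> b x = b' x) \<Longrightarrow> pvalue A b p = pvalue A b' p"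
  by (induction p) auto

lemma kcomb_pvalue_le:
  assumes "y \<notin> pvars t" "pvalue A b t \<in> carrier A" "c \<in> carrier A"
  shows "kcomb A \<cdot> pvalue A b t \<cdot> c \<sqsubseteq> pvalue A (b(y := c)) t"
proof -
  have "pvalue A (b(y := c)) t = pvalue A b t"
    using assms(1) by (intro pvalue_cong) auto
  then show ?thesis using kcomb_le assms by simp
qed

text \<open>
  The clauses of \<open>\<lambda>\<^sup>*\<close> mirror the combinator inequalities: \<open>k\<close> discards the argument where \<open>y\<close>
  does not occur, \<open>skk\<close> is below the identity, and \<open>s\<close> distributes the argument over an
  application in which \<open>y\<close> occurs, where monotonicity then lets both operands be reduced in place.
\<close>

lemma lamstar_beta:
  assumes "p \<in> polynomials A X" "\<And>x. x \<in> X - {y} \<Longrightarrow> b x \<in> carrier A" "c \<in> carrier A"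
  shows "pvalue A b (lamstar A y p) \<cdot> c \<sqsubseteq> pvalue A (b(y := c)) p"
  using assms(1)
proof (induction p)
  case (PVar x)
  show ?case
  proof (cases "x = y")
    case True
    let ?k = "kcomb A"
    have "scomb A \<cdot> ?k \<cdot> ?k \<cdot> c \<sqsubseteq> ?k \<cdot> c \<cdot> (?k \<cdot> c)"
      by (intro scomb_le kcomb_closed assms(3))
    moreover have "?k \<cdot> c \<cdot> (?k \<cdot> c) \<sqsubseteq> c"
      by (intro kcomb_le appl_closed kcomb_closed assms(3))
    ultimately have "scomb A \<cdot> ?k \<cdot> ?k \<cdot> c \<sqsubseteq> c"
      by (rule le_trans) (simp_all add: appl_closed scomb_closed kcomb_closed assms(3))
    then show ?thesis using True by simp
  next
    case False
    then have "b x \<in> carrier A" using PVar assms(2) by (auto simp: polynomials_def)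
    then show ?thesis using kcomb_le assms(3) False by simp
  qed
next
  case (PElt a)
  then show ?case using kcomb_le assms(3) by (simp add: polynomials_def)
next
  case (PApp t u)
  have tu: "t \<in> polynomials A X" "u \<in> polynomials A X"
    using PApp.prems by (auto simp: polynomials_def)
  show ?case
  proof (cases "y \<in> pvars (PApp t u)")
    case False
    have "PApp t u \<in> polynomials A (X - {y})"
      using PApp.prems False by (auto simp: polynomials_def)
    then have "pvalue A b (PApp t u) \<in> carrier A"
      by (rule pvalue_closed) (fact assms(2))
    from kcomb_pvalue_le[OF False this assms(3)] False show ?thesis
      by (simp add: fun_upd_def)
  next
    case True
    let ?T = "pvalue A b (lamstar A y t)" and ?U = "pvalue A b (lamstar A y u)"
    let ?t = "pvalue A (b(y := c)) t" and ?u = "pvalue A (b(y := c)) u"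
    have closed: "?T \<in> carrier A" "?U \<in> carrier A"
      by (auto intro!: pvalue_closed[OF lamstar_polynomial] tu assms(2))
    have closed': "?t \<in> carrier A" "?u \<in> carrier A"
      using assms(2,3) by (auto intro!: pvalue_closed[OF tu(1)] pvalue_closed[OF tu(2)])
    have "scomb A \<cdot> ?T \<cdot> ?U \<cdot> c \<sqsubseteq> ?T \<cdot> c \<cdot> (?U \<cdot> c)"
      by (intro scomb_le closed assms(3))
    moreover have "?T \<cdot> c \<cdot> (?U \<cdot> c) \<sqsubseteq> ?t \<cdot> ?u"
      by (intro appl_mono PApp.IH tu appl_closed closed closed' assms(3))
    ultimately have "scomb A \<cdot> ?T \<cdot> ?U \<cdot> c \<sqsubseteq> ?t \<cdot> ?u"
      by (rule le_trans) (simp_all add: appl_closed scomb_closed closed closed' assms(3))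
    then show ?thesis using True by (auto simp: fun_upd_def)
  qed
qed

end

section \<open>Infima and the adjunction\<close>

context KOCA
begin

lemma inf_is_greatest_Lower:
  assumes "X \<subseteq> carrier A"
  shows "greatest A (\<Sqinter>X) (Lower A X)"
  using someI_ex[OF inf_exists[OF assms]] by (simp add: inf_def)

lemma inf_closed: "X \<subseteq> carrier A \<Longrightarrow> \<Sqinter>X \<in> carrier A"
  using inf_is_greatest_Lower by (auto dest: greatest_closed)

lemma inf_le_member: "X \<subseteq> carrier A \<Longrightarrow> x \<in> X \<Longrightarrow> \<Sqinter>X \<sqsubseteq> x"
  using greatest_Lower_below[OF inf_is_greatest_Lower] by blast

lemma le_infI:
  assumes "X \<subseteq> carrier A" "a \<in> carrier A" "\<And>x. x \<in> X \<Longrightarrow> a \<sqsubseteq> x"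
  shows "a \<sqsubseteq> \<Sqinter>X"
  using greatest_le[OF inf_is_greatest_Lower[OF assms(1)]] assms by (auto simp: Lower_def)

lemma impl_closed: "a \<in> carrier A \<Longrightarrow> b \<in> carrier A \<Longrightarrow> impl A a b \<in> carrier A"
  using implication by (simp add: implication_def)

lemma appl_le_if_le_impl:
  "\<lbrakk>a \<in> carrier A; b \<in> carrier A; c \<in> carrier A; a \<sqsubseteq> impl A b c\<rbrakk> \<Longrightarrow> a \<cdot> b \<sqsubseteq> c"
  using implication by (simp add: implication_def)

lemma adj_appl_le_impl_if_appl_le:
  "\<lbrakk>a \<in> carrier A; b \<in> carrier A; c \<in> carrier A; a \<cdot> b \<sqsubseteq> c\<rbrakk> \<Longrightarrow> adj A \<cdot> a \<sqsubseteq> impl A b c"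
  using adjunctor by (simp add: adjunctor_def)

end

section \<open>Substitution\<close>

lemma sem_cong:
  "(\<And>v. v \<in> FV M \<Longrightarrow> \<aa> v = \<bb> v) \<Longrightarrow> sem A I \<aa> M = sem A I \<bb> M"
proof (induction M arbitrary: \<aa> \<bb>)
  case (Lam v M)
  have "sem A I (\<aa>(v := s)) M = sem A I (\<bb>(v := s)) M" for s
    using Lam.prems by (intro Lam.IH) auto
  then show ?case by simp
next
  case (App N M)
  have "sem A I \<aa> N = sem A I \<bb> N" "sem A I \<aa> M = sem A I \<bb> M"
    using App.prems by (auto intro!: App.IH)
  then show ?case by simp
next
  case (Imp B C)
  have "sem A I \<aa> B = sem A I \<bb> B" "sem A I \<aa> C = sem A I \<bb> C"
    using Imp.prems by (auto intro!: Imp.IH)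
  then show ?case by simp
next
  case (All v B)
  have "sem A I (\<aa>(v := s)) B = sem A I (\<bb>(v := s)) B" for s
    using All.prems by (intro All.IH) auto
  then show ?case by simp
qed auto

lemma finite_FV: "finite (FV M)"
  by (induction M) auto

lemma fresh_binder_kind: "snd (fresh_binder \<theta> v M) = snd v"
  by (simp add: fresh_binder_def Let_def)

lemma fresh_binder_not_captured:
  assumes "w \<in> FV M" "w \<noteq> v"
  shows "fresh_binder \<theta> v M \<notin> FV (\<theta> w)"
proof -
  define avoid where "avoid = (\<Union>w\<in>FV M - {v}. FV (\<theta> w))"
  have "finite (fst ` avoid)" by (simp add: avoid_def finite_FV)
  then obtain n where "n \<notin> fst ` avoid" using ex_new_if_finite infinite_UNIV_nat by blast
  then have "(n, snd v) \<notin> avoid" by force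
  then have "(LEAST n. (n, snd v) \<notin> avoid, snd v) \<notin> avoid" by (rule LeastI)
  then have "fresh_binder \<theta> v M \<notin> avoid"
    by (simp add: fresh_binder_def avoid_def[symmetric])
  then show ?thesis using assms by (auto simp: avoid_def)
qed

lemma kind_of_subst:
  "(\<And>w. w \<in> FV M \<Longrightarrow> kind_of (\<theta> w) = snd w) \<Longrightarrow> kind_of (subst M \<theta>) = kind_of M"
proof (induction M arbitrary: \<theta>)
  case (Lam v M)
  have "kind_of (subst M (\<theta>(v := Var (fresh_binder \<theta> v M)))) = kind_of M"
    using Lam.prems by (intro Lam.IH) (auto simp: fresh_binder_kind)
  then show ?case by (simp add: Let_def fresh_binder_kind)
qed (auto simp: Let_def)

text \<open>
  Under a binder, the renamed bound variable takes over the value of the old one, and it occurs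
  in no expression that is substituted for another free variable of the body; so giving it a value
  does not disturb what those expressions denote.
\<close>

lemma sem_under_binder:
  fixes \<theta> :: "'c var \<Rightarrow> ('c, 'k) expr" and M :: "('c, 'k) expr"
  fixes v :: "'c var"
  defines "z \<equiv> fresh_binder \<theta> v M"
  shows "sem A I (\<lambda>w. sem A I (\<aa>(z := s)) ((\<theta>(v := Var z)) w)) M =
    sem A I ((\<lambda>w. sem A I \<aa> (\<theta> w))(v := s)) M"
proof (rule sem_cong)
  fix w assume "w \<in> FV M"
  then have "w \<noteq> v \<Longrightarrow> z \<notin> FV (\<theta> w)"
    unfolding z_def by (rule fresh_binder_not_captured)
  then have "w \<noteq> v \<Longrightarrow> sem A I (\<aa>(z := s)) (\<theta> w) = sem A I \<aa> (\<theta> w)"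
    by (intro sem_cong) auto
  then show "sem A I (\<aa>(z := s)) ((\<theta>(v := Var z)) w) =
      ((\<lambda>w. sem A I \<aa> (\<theta> w))(v := s)) w"
    by simp
qed

text \<open>
  Kinds have to be preserved because the meaning of an abstraction or an application is computed
  in the function space that the kinds of its parts determine.
\<close>

lemma sem_subst:
  "(\<And>w. w \<in> FV M \<Longrightarrow> kind_of (\<theta> w) = snd w) \<Longrightarrow>
    sem A I \<aa> (subst M \<theta>) = sem A I (\<lambda>w. sem A I \<aa> (\<theta> w)) M"
proof (induction M arbitrary: \<theta> \<aa>)
  case (Lam v M)
  let ?\<theta> = "\<theta>(v := Var (fresh_binder \<theta> v M))"
  have kinds: "\<And>w. w \<in> FV M \<Longrightarrow> kind_of (?\<theta> w) = snd w"
    using Lam.prems by (auto simp: fresh_binder_kind)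
  show ?case
    using kind_of_subst[OF kinds] Lam.IH[OF kinds]
    by (simp add: Let_def fresh_binder_kind sem_under_binder del: fun_upd_apply)
next
  case (App N M)
  then have kinds: "kind_of (subst N \<theta>) = kind_of N" "kind_of (subst M \<theta>) = kind_of M"
    by (auto intro!: kind_of_subst)
  have "sem A I \<aa> (subst N \<theta>) = sem A I (\<lambda>w. sem A I \<aa> (\<theta> w)) N"
    "sem A I \<aa> (subst M \<theta>) = sem A I (\<lambda>w. sem A I \<aa> (\<theta> w)) M"
    using App.prems by (auto intro!: App.IH)
  then show ?case using kinds by simp
next
  case (Imp B C)
  have "sem A I \<aa> (subst B \<theta>) = sem A I (\<lambda>w. sem A I \<aa> (\<theta> w)) B"
    "sem A I \<aa> (subst C \<theta>) = sem A I (\<lambda>w. sem A I \<aa> (\<theta> w)) C"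
    using Imp.prems by (auto intro!: Imp.IH)
  then show ?case by simp
next
  case (All v B)
  let ?\<theta> = "\<theta>(v := Var (fresh_binder \<theta> v B))"
  have kinds: "\<And>w. w \<in> FV B \<Longrightarrow> kind_of (?\<theta> w) = snd w"
    using All.prems by (auto simp: fresh_binder_kind)
  show ?case
    using All.IH[OF kinds]
    by (simp add: Let_def fresh_binder_kind sem_under_binder del: fun_upd_apply)
qed auto

lemma sem_subst1:
  assumes "kind_of M = snd v"
  shows "sem A I \<aa> (subst1 B v M) = sem A I (\<aa>(v := sem A I \<aa> M)) B"
proof -
  have "sem A I \<aa> (subst1 B v M) = sem A I (\<lambda>w. sem A I \<aa> ((Var(v := M)) w)) B"
    unfolding subst1_def using assms by (intro sem_subst) simp
  also have "\<dots> = sem A I (\<aa>(v := sem A I \<aa> M)) B"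
    by (intro sem_cong) simp
  finally show ?thesis .
qed

section \<open>Expressions denote elements of their kinds\<close>

lemma is_languageD:
  assumes "is_language L"
  shows "Omicron \<in> kinds L"
    and "Arr \<sigma> \<tau> \<in> kinds L \<Longrightarrow> \<tau> \<in> kinds L"
    and "(a, \<sigma>) \<in> csts L \<Longrightarrow> \<sigma> \<in> kinds L"
  using assms unfolding is_language_def by blast+

lemma kind_of_in_kinds:
  assumes "is_language L" "wf_expr L M"
  shows "kind_of M \<in> kinds L"
  using assms(2)
proof (induction M)
  case (App N M)
  then obtain \<tau> where "kind_of N = Arr (kind_of M) \<tau>" "Arr (kind_of M) \<tau> \<in> kinds L"
    by auto
  then show ?case using is_languageD(2)[OF assms(1)] by simp
qed (simp_all add: is_languageD(1)[OF assms(1)] is_languageD(3)[OF assms(1)])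

locale KOCA_model = KOCA A for A :: "'v koca" (structure) +
  fixes L :: "('c, 'k) language" and I :: "('c, 'k, 'v) interp"
  assumes language: "is_language L"
    and interp: "is_interp L A I"
begin

lemma Dom_Omicron: "Dom I Omicron = carrier A"
  using interp by (simp add: is_interp_def)

lemma Ap_bij_betw:
  "Arr \<sigma> \<tau> \<in> kinds L \<Longrightarrow>
    bij_betw (\<lambda>f. restrict (Ap I \<sigma> \<tau> f) (Dom I \<sigma>)) (Dom I (Arr \<sigma> \<tau>)) (Dom I \<sigma> \<rightarrow>\<^sub>E Dom I \<tau>)"
  using interp by (simp add: is_interp_def)

lemma Ap_closed:
  assumes "Arr \<sigma> \<tau> \<in> kinds L" "f \<in> Dom I (Arr \<sigma> \<tau>)" "s \<in> Dom I \<sigma>"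
  shows "Ap I \<sigma> \<tau> f s \<in> Dom I \<tau>"
proof -
  have "restrict (Ap I \<sigma> \<tau> f) (Dom I \<sigma>) \<in> Dom I \<sigma> \<rightarrow>\<^sub>E Dom I \<tau>"
    using bij_betw_apply[OF Ap_bij_betw[OF assms(1)] assms(2)] .
  from PiE_mem[OF this assms(3)] assms(3) show ?thesis by simp
qed

text \<open>
  This makes the definite description in the meaning of \<open>Lam\<close> well defined: surjectivity of the
  representation of functions yields a representative, and injectivity its uniqueness.
\<close>

lemma ex1_representative:
  assumes "Arr \<sigma> \<tau> \<in> kinds L" "\<And>s. s \<in> Dom I \<sigma> \<Longrightarrow> g s \<in> Dom I \<tau>"
  shows "\<exists>!f. f \<in> Dom I (Arr \<sigma> \<tau>) \<and> (\<forall>s\<in>Dom I \<sigma>. Ap I \<sigma> \<tau> f s = g s)"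
proof -
  let ?rep = "\<lambda>f. restrict (Ap I \<sigma> \<tau> f) (Dom I \<sigma>)"
  have "restrict g (Dom I \<sigma>) \<in> ?rep ` Dom I (Arr \<sigma> \<tau>)"
    using assms(2) bij_betw_imp_surj_on[OF Ap_bij_betw[OF assms(1)]] by simp
  then have "\<exists>!f. f \<in> Dom I (Arr \<sigma> \<tau>) \<and> ?rep f = restrict g (Dom I \<sigma>)"
  proof (elim imageE, intro ex1I conjI)
    fix f f'
    assume f: "restrict g (Dom I \<sigma>) = ?rep f" "f \<in> Dom I (Arr \<sigma> \<tau>)"
      and f': "f' \<in> Dom I (Arr \<sigma> \<tau>) \<and> ?rep f' = restrict g (Dom I \<sigma>)"
    show "f' = f"
      by (rule inj_onD[OF bij_betw_imp_inj_on[OF Ap_bij_betw[OF assms(1)]]]) (use f f' in auto)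
  qed auto
  moreover have "?rep f = restrict g (Dom I \<sigma>) \<longleftrightarrow> (\<forall>s\<in>Dom I \<sigma>. Ap I \<sigma> \<tau> f s = g s)" for f
    by (auto simp: restrict_def fun_eq_iff)
  ultimately show ?thesis by simp
qed

lemma assignment_update:
  "\<aa> \<in> assignments L I \<Longrightarrow> s \<in> Dom I (snd v) \<Longrightarrow> \<aa>(v := s) \<in> assignments L I"
  by (auto simp: assignments_def)

lemma sem_in_Dom:
  "wf_expr L M \<Longrightarrow> \<aa> \<in> assignments L I \<Longrightarrow> sem A I \<aa> M \<in> Dom I (kind_of M)"
proof (induction M arbitrary: \<aa>)
  case (Var v)
  then show ?case by (simp add: assignments_def del: split_paired_All)
next
  case (Cst a \<sigma>)
  then show ?case using interp by (auto simp: is_interp_def)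
next
  case (Lam v M)
  have "\<exists>!f. f \<in> Dom I (Arr (snd v) (kind_of M)) \<and>
      (\<forall>s\<in>Dom I (snd v). Ap I (snd v) (kind_of M) f s = sem A I (\<aa>(v := s)) M)"
    using Lam by (intro ex1_representative) (auto intro: assignment_update)
  from theI'[OF this] show ?case by simp
next
  case (App N M)
  then obtain \<tau> where \<tau>: "kind_of N = Arr (kind_of M) \<tau>" by auto
  have "Arr (kind_of M) \<tau> \<in> kinds L"
    using kind_of_in_kinds[OF language, of N] App.prems(1) \<tau> by simp
  then show ?case using App \<tau> by (simp add: Ap_closed)
next
  case (Imp B C)
  then have "sem A I \<aa> B \<in> carrier A" "sem A I \<aa> C \<in> carrier A"
    using Imp.IH(1)[of \<aa>] Imp.IH(2)[of \<aa>] by (simp_all add: Dom_Omicron)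
  then show ?case by (simp add: impl_closed Dom_Omicron)
next
  case (All v B)
  then have "sem A I (\<aa>(v := s)) B \<in> carrier A" if "s \<in> Dom I (snd v)" for s
    using All.IH[OF _ assignment_update[OF _ that]] by (simp add: Dom_Omicron fun_upd_def)
  then have "sem A I \<aa> (All v B) \<in> carrier A"
    by (auto intro!: inf_closed)
  then show ?case by (simp add: Dom_Omicron)
qed

lemma sem_formula_closed:
  "B \<in> formulae L \<Longrightarrow> \<aa> \<in> assignments L I \<Longrightarrow> sem A I \<aa> B \<in> carrier A"
  using sem_in_Dom[of B \<aa>] by (simp add: expressions_def Dom_Omicron)

lemma all_family_closed:
  assumes "B \<in> formulae L" "\<aa> \<in> assignments L I"
  shows "{sem A I (\<aa>(v := s)) B | s. s \<in> Dom I (snd v)} \<subseteq> carrier A"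
  by (blast intro: sem_formula_closed[OF assms(1) assignment_update[OF assms(2)]])

section \<open>Adequacy of the rules\<close>

abbreviation realizes :: "(nat \<Rightarrow> 'v) \<Rightarrow> ('c, 'v) assignment \<Rightarrow> ('c, 'k) ctxt \<Rightarrow> bool" where
  "realizes b \<aa> \<Gamma> \<equiv> \<forall>(x, C)\<in>set \<Gamma>. b x \<in> carrier A \<and> b x \<sqsubseteq> sem A I \<aa> C"

lemma satisfiesD:
  "\<lbrakk>satisfies L A I (\<Gamma>, p, B); \<aa> \<in> assignments L I; realizes b \<aa> \<Gamma>\<rbrakk>
    \<Longrightarrow> pvalue A b p \<sqsubseteq> sem A I \<aa> B"
  by (auto simp: satisfies_def)

lemma satisfiesI:
  "(\<And>\<aa> b. \<lbrakk>\<aa> \<in> assignments L I; realizes b \<aa> \<Gamma>\<rbrakk> \<Longrightarrow> pvalue A b p \<sqsubseteq> sem A I \<aa> B)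
    \<Longrightarrow> satisfies L A I (\<Gamma>, p, B)"
  by (auto simp: satisfies_def)

lemma realizer_closed:
  assumes "p \<in> polynomials A (fst ` set \<Gamma>)" "realizes b \<aa> \<Gamma>"
  shows "pvalue A b p \<in> carrier A"
  using assms(2) by (intro pvalue_closed[OF assms(1)]) auto

lemma satisfies_ax: "(x, B) \<in> set \<Gamma> \<Longrightarrow> satisfies L A I (\<Gamma>, PVar x, B)"
  by (rule satisfiesI) auto

lemma satisfies_imp_intro:
  assumes seq: "(\<Gamma> @ [(x, C)], p, B) \<in> sequents L A"
    and prem: "satisfies L A I (\<Gamma> @ [(x, C)], p, B)"
  shows "satisfies L A I (\<Gamma>, PApp (PElt (adj A)) (lamstar A x p), Imp C B)"
proof (rule satisfiesI)
  fix \<aa> b assume \<aa>: "\<aa> \<in> assignments L I" and b: "realizes b \<aa> \<Gamma>"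
  let ?q = "pvalue A b (lamstar A x p)" and ?c = "sem A I \<aa> C" and ?d = "sem A I \<aa> B"
  have x: "x \<notin> fst ` set \<Gamma>" and p: "p \<in> polynomials A (insert x (fst ` set \<Gamma>))"
    and "C \<in> formulae L" "B \<in> formulae L"
    using seq by (auto simp: sequents_def contexts_def)
  then have cd: "?c \<in> carrier A" "?d \<in> carrier A" using sem_formula_closed \<aa> by auto
  have b_closed: "b y \<in> carrier A" if "y \<in> insert x (fst ` set \<Gamma>) - {x}" for y
    using b that by auto
  have "?q \<in> carrier A"
    by (rule pvalue_closed[OF lamstar_polynomial[OF p] b_closed])
  moreover have "?q \<cdot> ?c \<sqsubseteq> ?d"
  proof (rule le_trans)
    show "?q \<cdot> ?c \<sqsubseteq> pvalue A (b(x := ?c)) p"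
      by (rule lamstar_beta[OF p b_closed cd(1)])
    \<comment> \<open>\<open>x\<close> is not declared in \<open>\<Gamma>\<close>, so \<open>b\<close> can be redefined at \<open>x\<close> to realize \<open>C\<close> as well.\<close>
    have "realizes (b(x := ?c)) \<aa> (\<Gamma> @ [(x, C)])"
    proof (clarify, intro conjI)
      fix y D assume D: "(y, D) \<in> set (\<Gamma> @ [(x, C)])"
      have "y \<noteq> x" if "(y, D) \<in> set \<Gamma>" using that x by (metis fst_conv imageI)
      then show "(b(x := ?c)) y \<in> carrier A" "(b(x := ?c)) y \<sqsubseteq> sem A I \<aa> D"
        using D b cd(1) by auto
    qed
    then show "pvalue A (b(x := ?c)) p \<sqsubseteq> ?d" by (rule satisfiesD[OF prem \<aa>])
    show "pvalue A (b(x := ?c)) p \<in> carrier A"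
      using b_closed cd(1) by (intro pvalue_closed[OF p]) auto
  qed (simp_all add: cd appl_closed \<open>?q \<in> carrier A\<close>)
  ultimately show "pvalue A b (PApp (PElt (adj A)) (lamstar A x p)) \<sqsubseteq> sem A I \<aa> (Imp C B)"
    using adj_appl_le_impl_if_appl_le[OF _ cd] by simp
qed

lemma satisfies_imp_elim:
  assumes seq: "(\<Gamma>, p, Imp C B) \<in> sequents L A" "(\<Gamma>, q, C) \<in> sequents L A"
    and prems: "satisfies L A I (\<Gamma>, p, Imp C B)" "satisfies L A I (\<Gamma>, q, C)"
  shows "satisfies L A I (\<Gamma>, PApp p q, B)"
proof (rule satisfiesI)
  fix \<aa> b assume \<aa>: "\<aa> \<in> assignments L I" and b: "realizes b \<aa> \<Gamma>"
  let ?p = "pvalue A b p" and ?q = "pvalue A b q"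
  let ?c = "sem A I \<aa> C" and ?d = "sem A I \<aa> B"
  have "C \<in> formulae L" "B \<in> formulae L"
    using seq by (auto simp: sequents_def expressions_def)
  then have cd: "?c \<in> carrier A" "?d \<in> carrier A" using sem_formula_closed \<aa> by auto
  have pq: "?p \<in> carrier A" "?q \<in> carrier A"
    using seq b by (auto simp: sequents_def intro!: realizer_closed)
  have "?p \<sqsubseteq> impl A ?c ?d" using satisfiesD[OF prems(1) \<aa> b] by simp
  then have imp: "?p \<cdot> ?c \<sqsubseteq> ?d" by (intro appl_le_if_le_impl pq cd)
  have "?p \<cdot> ?q \<sqsubseteq> ?p \<cdot> ?c"
    by (intro appl_mono pq cd satisfiesD[OF prems(2) \<aa> b] le_refl)
  from this imp have "?p \<cdot> ?q \<sqsubseteq> ?d"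
    by (rule le_trans) (simp_all add: appl_closed pq cd)
  then show "pvalue A b (PApp p q) \<sqsubseteq> ?d" by simp
qed

lemma satisfies_all_intro:
  assumes seq: "(\<Gamma>, p, B) \<in> sequents L A"
    and fresh: "\<forall>(y, C)\<in>set \<Gamma>. v \<notin> FV C"
    and prem: "satisfies L A I (\<Gamma>, p, B)"
  shows "satisfies L A I (\<Gamma>, p, All v B)"
proof (rule satisfiesI)
  fix \<aa> b assume \<aa>: "\<aa> \<in> assignments L I" and b: "realizes b \<aa> \<Gamma>"
  have "pvalue A b p \<sqsubseteq> sem A I (\<aa>(v := s)) B" if "s \<in> Dom I (snd v)" for s
  proof (rule satisfiesD[OF prem])
    show "\<aa>(v := s) \<in> assignments L I" by (rule assignment_update[OF \<aa> that])
    have "sem A I (\<aa>(v := s)) C = sem A I \<aa> C" if "(y, C) \<in> set \<Gamma>" for y C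
      using fresh that by (intro sem_cong) auto
    then show "realizes b (\<aa>(v := s)) \<Gamma>" using b by (auto simp: fun_upd_def)
  qed
  moreover have "B \<in> formulae L" and "pvalue A b p \<in> carrier A"
    using seq b by (auto simp: sequents_def intro!: realizer_closed)
  ultimately show "pvalue A b p \<sqsubseteq> sem A I \<aa> (All v B)"
    by (auto simp: fun_upd_def intro!: le_infI[OF all_family_closed[OF _ \<aa>, unfolded fun_upd_def]])
qed

lemma satisfies_all_elim:
  assumes seq: "(\<Gamma>, p, All v B) \<in> sequents L A"
    and M: "M \<in> expressions L (snd v)"
    and prem: "satisfies L A I (\<Gamma>, p, All v B)"
  shows "satisfies L A I (\<Gamma>, p, subst1 B v M)"
proof (rule satisfiesI)
  fix \<aa> b assume \<aa>: "\<aa> \<in> assignments L I" and b: "realizes b \<aa> \<Gamma>"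
  let ?m = "sem A I \<aa> M"
  let ?family = "{sem A I (\<aa>(v := s)) B | s. s \<in> Dom I (snd v)}"
  have B: "B \<in> formulae L" and p: "pvalue A b p \<in> carrier A"
    using seq b by (auto simp: sequents_def expressions_def intro!: realizer_closed)
  have m: "?m \<in> Dom I (snd v)"
    using sem_in_Dom[of M \<aa>] M \<aa> by (simp add: expressions_def)
  note closed = all_family_closed[OF B \<aa>, of v]
  have "pvalue A b p \<sqsubseteq> \<Sqinter>?family" using satisfiesD[OF prem \<aa> b] by simp
  moreover have "\<Sqinter>?family \<sqsubseteq> sem A I (\<aa>(v := ?m)) B"
    by (rule inf_le_member[OF closed]) (use m in auto)
  ultimately have "pvalue A b p \<sqsubseteq> sem A I (\<aa>(v := ?m)) B"
    by (rule le_trans[OF _ _ p inf_closed[OF closed]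
          sem_formula_closed[OF B assignment_update[OF \<aa> m]]])
  then show "pvalue A b p \<sqsubseteq> sem A I \<aa> (subst1 B v M)"
    using M by (simp add: sem_subst1 expressions_def)
qed

end

lemma adequateI:
  fixes L :: "('c, 'k) language" and R :: "('c, 'k, 'v) rule"
  assumes "is_language L"
    and "\<And>A I Ps S. \<lbrakk>KOCA_model A L I; (Ps, S) \<in> R A; \<forall>P\<in>set Ps. satisfies L A I P\<rbrakk>
      \<Longrightarrow> satisfies L A I S"
  shows "adequate L R"
  using assms unfolding adequate_def KOCA_model_def KOCA_model_axioms_def by blast

theorem theorem9p4:
  fixes L :: "('c, 'k) language"
  assumes "is_language L"
  shows "adequate L (rule_ax L :: ('c, 'k, 'v) rule)
    \<and> adequate L (rule_imp_intro L :: ('c, 'k, 'v) rule)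
    \<and> adequate L (rule_imp_elim L :: ('c, 'k, 'v) rule)
    \<and> adequate L (rule_all_intro L :: ('c, 'k, 'v) rule)
    \<and> adequate L (rule_all_elim L :: ('c, 'k, 'v) rule)"
proof (intro conjI; rule adequateI[OF assms])
  fix A :: "'v koca" and I :: "('c, 'k, 'v) interp"
    and Ps :: "('c, 'k, 'v) sequent list" and S :: "('c, 'k, 'v) sequent"
  assume "KOCA_model A L I" and prems: "\<forall>P\<in>set Ps. satisfies L A I P"
  then interpret KOCA_model A L I by simp
  show "satisfies L A I S" if "(Ps, S) \<in> rule_ax L A"
    using that by (auto simp: rule_ax_def intro: satisfies_ax)
  show "satisfies L A I S" if "(Ps, S) \<in> rule_imp_intro L A"
    using that prems by (auto simp: rule_imp_intro_def intro: satisfies_imp_intro)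
  show "satisfies L A I S" if "(Ps, S) \<in> rule_imp_elim L A"
    using that prems by (auto simp: rule_imp_elim_def intro: satisfies_imp_elim)
  show "satisfies L A I S" if "(Ps, S) \<in> rule_all_intro L A"
    using that prems by (auto simp: rule_all_intro_def intro: satisfies_all_intro)
  show "satisfies L A I S" if "(Ps, S) \<in> rule_all_elim L A"
    using that prems by (auto simp: rule_all_elim_def intro: satisfies_all_elim)
qed

end
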